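(* Let $r \ge 2$ and $n \ge 6r-10$ be integers with $n \geq 3$, and suppose $H$ is an $n$-vertex $r$-graph with $\delta_{r-1}^+(H) \geq \frac{n}{2} - r + 2$ and no isolated vertices. Then $H$ contains a Berge Hamiltonian cycle.
   Context: An $r$-graph $H=(V,E)$ is an $r$-uniform hypergraph: $V=V(H)$ is a finite vertex set and $E=E(H) \subseteq \binom{V}{r}$ is a set of $r$-element subsets of $V$, called edges. A vertex is isolated if it lies in no edge of $H$. For an $(r-1)$-element set $S\subseteq V(H)$, its co-degree $d_{r-1}(S)$ is the number of edges of $H$ containing $S$. The minimum positive co-degree $\delta_{r-1}^+(H)$ is the largest integer $k$ such that for every $S \in \binom{V}{r-1}$ either $d_{r-1}(S)=0$ or $d_{r-1}(S)\ge k$; if $H$ has no edges, $\delta_{r-1}^+(H)=0$. A Berge cycle of length $k$ in $H$ is an ordered list $(v_1,e_1,v_2,e_2,\dots,e_{k-1},v_k,e_k,v_1)$, where $v_1,\dots,v_k$ are pairwise distinct vertices of $H$ and $e_1,\dots,e_k$ are pairwise distinct edges of $H$, such that for each $i\in\{1,\dots,k\}$ both $v_i$ and $v_{i+1}$ are contained in $e_i$ (subscripts modulo $k$). A Berge Hamiltonian cycle of an $n$-vertex $H$ is a Berge cycle of length $n$ (so that $v_1,\dots,v_n$ are all the vertices of $H$). *)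

theory Defs
  imports Complex_Main "HOL-Library.Ramsey"
begin

text \<open>A hypergraph is given by its vertex set \<open>V\<close> and edge set \<open>E\<close>; the library's \<open>nsets V r\<close> is
  the set of \<open>r\<close>-element subsets of \<open>V\<close>.\<close>

definition rgraph :: "nat \<Rightarrow> 'a set \<Rightarrow> 'a set set \<Rightarrow> bool" where
  "rgraph r V E \<longleftrightarrow> finite V \<and> E \<subseteq> nsets V r"

definition isolated :: "'a set set \<Rightarrow> 'a \<Rightarrow> bool" where
  "isolated E v \<longleftrightarrow> (\<forall>e\<in>E. v \<notin> e)"

definition codegree :: "'a set set \<Rightarrow> 'a set \<Rightarrow> nat" where
  "codegree E S = card {e \<in> E. S \<subseteq> e}"

text \<open>For an \<open>r\<close>-graph with \<open>r \<ge> 1\<close> and at least one edge, the predicate under \<open>GREATEST\<close> holds at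
  \<open>0\<close> and is bounded, so ranging over naturals instead of integers makes no difference and the
  maximum exists.\<close>

definition min_pos_codegree :: "nat \<Rightarrow> 'a set \<Rightarrow> 'a set set \<Rightarrow> nat" where
  "min_pos_codegree r V E =
     (if E = {} then 0
      else (GREATEST k. \<forall>S \<in> nsets V (r - 1). codegree E S = 0 \<or> k \<le> codegree E S))"

text \<open>The cycle \<open>(v\<^sub>1, e\<^sub>1, \<dots>, v\<^sub>k, e\<^sub>k, v\<^sub>1)\<close> is encoded by the list \<open>vs\<close> of its vertices and
  the list \<open>es\<close> of its edges, both indexed from \<open>0\<close>.\<close>

definition berge_cycle :: "'a set \<Rightarrow> 'a set set \<Rightarrow> nat \<Rightarrow> 'a list \<Rightarrow> 'a set list \<Rightarrow> bool" where
  "berge_cycle V E k vs es \<longleftrightarrow>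
     k \<ge> 1 \<and> length vs = k \<and> length es = k \<and>
     distinct vs \<and> set vs \<subseteq> V \<and> distinct es \<and> set es \<subseteq> E \<and>
     (\<forall>i<k. vs ! i \<in> es ! i \<and> vs ! ((i + 1) mod k) \<in> es ! i)"

definition berge_hamiltonian_cycle :: "'a set \<Rightarrow> 'a set set \<Rightarrow> 'a list \<Rightarrow> 'a set list \<Rightarrow> bool" where
  "berge_hamiltonian_cycle V E vs es \<longleftrightarrow> berge_cycle V E (card V) vs es"

end

theory Submission
  imports Defs
begin

text \<open>
  Call two vertices adjacent when some edge of the hypergraph contains both. Extending an
  \<open>(r - 1)\<close>-subset of an edge through a vertex \<open>v\<close> shows that \<open>v\<close> has at least
  \<open>(n/2 - r + 2) + (r - 2) = n/2\<close> neighbours: the possible extensions and the other elements of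
  the subset. Hence Dirac's theorem (\<open>dirac\<close>) provides a Hamiltonian cycle of this shadow graph.

  It remains to choose distinct hyperedges for the \<open>n\<close> pairs of cyclically consecutive vertices,
  and this is a marriage problem (\<open>hall\<close>) that is solved by double counting
  (\<open>hall_of_degrees\<close>). A hyperedge contains at most \<open>r - 1\<close> of the pairs, since the indices of
  its \<open>r < n\<close> vertices are not closed under the cyclic successor
  (\<open>card_consecutive_pairs_less\<close>). A pair lies in at least \<open>r - 1\<close> hyperedges: for \<open>r = 2\<close> by
  adjacency, and for \<open>r \<ge> 3\<close> because it lies in an \<open>(r - 1)\<close>-set of positive co-degree, where
  \<open>n/2 - r + 2 \<ge> r - 1\<close>.
\<close>

section \<open>Dirac's theorem\<close>

text \<open>
  If the first vertex of a path is adjacent to \<open>xs ! Suc i\<close> and the last one to \<open>xs ! i\<close>, then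
  reversing the part after \<open>xs ! i\<close> closes the path to a cycle. Such an \<open>i\<close> exists by the
  pigeonhole principle: the indices suitable for the first vertex and those suitable for the last
  one number at least \<open>card A + card B \<ge> length xs\<close> together, but all of them are less than
  \<open>length xs - 1\<close>.
\<close>

lemma path_to_cycle:
  fixes adj :: "'a \<Rightarrow> 'a \<Rightarrow> bool"
  assumes sym: "\<And>u w. adj u w \<Longrightarrow> adj w u"
    and path: "successively adj xs" "xs \<noteq> []"
    and hd_nbrs: "A \<subseteq> set xs" "\<And>w. w \<in> A \<Longrightarrow> adj (hd xs) w \<and> w \<noteq> hd xs"
    and last_nbrs: "B \<subseteq> set xs" "\<And>w. w \<in> B \<Longrightarrow> adj (last xs) w \<and> w \<noteq> last xs"
    and deg: "length xs \<le> card A + card B"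
  obtains ys where "set ys = set xs" "length ys = length xs"
    "successively adj ys" "adj (last ys) (hd ys)"
proof -
  define k where "k = length xs - 1"
  have k: "length xs = Suc k" using path(2) by (simp add: k_def)
  have hd: "hd xs = xs ! 0" and last: "last xs = xs ! k"
    using path(2) by (simp_all add: hd_conv_nth last_conv_nth k_def)
  define I where "I = {i. i < k \<and> adj (xs ! 0) (xs ! Suc i)}"
  define J where "J = {i. i < k \<and> adj (xs ! k) (xs ! i)}"
  have fin: "finite I" "finite J" unfolding I_def J_def by auto
  have "A \<subseteq> (\<lambda>i. xs ! Suc i) ` I"
  proof
    fix w assume w: "w \<in> A"
    then obtain j where j: "j < Suc k" "xs ! j = w"
      using hd_nbrs(1) k by (metis in_set_conv_nth subsetD)
    with hd_nbrs(2)[OF w] hd have "j \<noteq> 0" by metis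
    then obtain i where "j = Suc i" by (cases j) auto
    with j hd_nbrs(2)[OF w] hd show "w \<in> (\<lambda>i. xs ! Suc i) ` I"
      unfolding I_def by (auto intro!: image_eqI[of _ _ i])
  qed
  then have A: "card A \<le> card I" using fin by (meson surj_card_le)
  have "B \<subseteq> (\<lambda>i. xs ! i) ` J"
  proof
    fix w assume w: "w \<in> B"
    then obtain j where j: "j < Suc k" "xs ! j = w"
      using last_nbrs(1) k by (metis in_set_conv_nth subsetD)
    with last_nbrs(2)[OF w] last have "j \<noteq> k" by metis
    with j last_nbrs(2)[OF w] last show "w \<in> (\<lambda>i. xs ! i) ` J"
      unfolding J_def by (auto intro!: image_eqI[of _ _ j])
  qed
  then have B: "card B \<le> card J" using fin by (meson surj_card_le)
  have "I \<inter> J \<noteq> {}"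
  proof
    assume "I \<inter> J = {}"
    then have "card I + card J = card (I \<union> J)" using fin by (simp add: card_Un_disjoint)
    also have "\<dots> \<le> card {..<k}" by (rule card_mono) (auto simp: I_def J_def)
    finally show False using A B deg k by simp
  qed
  then obtain i where i: "i < k" "adj (xs ! 0) (xs ! Suc i)" "adj (xs ! k) (xs ! i)"
    unfolding I_def J_def by auto
  define us where "us = take (Suc i) xs"
  define ws where "ws = drop (Suc i) xs"
  have xs: "xs = us @ ws" by (simp add: us_def ws_def)
  have ne: "us \<noteq> []" "ws \<noteq> []" using i(1) k by (auto simp: us_def ws_def)
  have ends: "hd us = xs ! 0" "last us = xs ! i" "hd ws = xs ! Suc i" "last ws = xs ! k"
    using i(1) k hd last ne
    by (auto simp: us_def ws_def hd_conv_nth last_conv_nth hd_drop_conv_nth min_def)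
  have succ: "successively adj us" "successively adj ws"
    using path(1) unfolding xs by (simp_all add: successively_append_iff)
  have "successively adj (rev ws)"
    using succ(2) by (simp add: successively_rev) (metis (mono_tags, lifting) succ(2) successively_mono sym)
  then have "successively adj (us @ rev ws)"
    using succ(1) ne ends i(3) sym by (simp add: successively_append_iff hd_rev)
  moreover have "adj (last (us @ rev ws)) (hd (us @ rev ws))"
    using ne ends i(2) sym by (simp add: last_rev)
  ultimately show ?thesis using that[of "us @ rev ws"] by (simp add: xs)
qed

text \<open>
  A longest path contains all neighbours of its ends, so it can be closed to a cycle on the same
  vertices, and there are more than \<open>card V / 2\<close> of them. A vertex outside has too many
  neighbours for all of them to lie outside as well; opening the cycle at a neighbour on it would
  yield a longer path.
\<close>

lemma dirac:
  fixes adj :: "'a \<Rightarrow> 'a \<Rightarrow> bool"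
  assumes V: "finite V" "V \<noteq> {}"
    and sym: "\<And>u w. adj u w \<Longrightarrow> adj w u"
    and irrefl: "\<And>u. \<not> adj u u"
    and deg: "\<And>v. v \<in> V \<Longrightarrow> card V \<le> 2 * card {w \<in> V. adj v w}"
  obtains vs where "distinct vs" "set vs = V"
    "\<And>i. i < length vs \<Longrightarrow> adj (vs ! i) (vs ! (Suc i mod length vs))"
proof -
  define path where "path xs \<longleftrightarrow> distinct xs \<and> set xs \<subseteq> V \<and> successively adj xs" for xs
  have path_length: "length xs \<le> card V" if "path xs" for xs
    using that V(1) unfolding path_def by (metis card_mono distinct_card)
  obtain v0 where "v0 \<in> V" using V(2) by blast
  then have "path [v0]" by (simp add: path_def)
  then obtain xs where xs: "path xs" and longest: "\<And>ys. path ys \<Longrightarrow> length ys \<le> length xs"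
    using ex_has_greatest_nat[of path "[v0]" length "Suc (card V)"] path_length
    by (auto simp: less_Suc_eq_le)
  have ne: "xs \<noteq> []" using longest[OF \<open>path [v0]\<close>] by auto
  let ?N = "\<lambda>v. {w \<in> V. adj v w}"
  have ends: "hd xs \<in> V" "last xs \<in> V" using xs ne unfolding path_def by auto
  have N_hd: "?N (hd xs) \<subseteq> set xs"
  proof (rule ccontr)
    assume "\<not> ?thesis"
    then obtain w where w: "w \<in> V" "adj (hd xs) w" "w \<notin> set xs" by blast
    then have "path (w # xs)" using xs ne sym unfolding path_def by (auto simp: successively_Cons)
    then show False using longest[of "w # xs"] by simp
  qed
  have N_last: "?N (last xs) \<subseteq> set xs"
  proof (rule ccontr)
    assume "\<not> ?thesis"
    then obtain w where w: "w \<in> V" "adj (last xs) w" "w \<notin> set xs" by blast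
    then have "path (xs @ [w])"
      using xs ne unfolding path_def by (auto simp: successively_append_iff)
    then show False using longest[of "xs @ [w]"] by simp
  qed
  have "length xs \<le> card (?N (hd xs)) + card (?N (last xs))"
    using path_length[OF xs] deg[OF ends(1)] deg[OF ends(2)] by linarith
  then obtain ys where ys: "set ys = set xs" "length ys = length xs"
    "successively adj ys" "adj (last ys) (hd ys)"
    using path_to_cycle[of adj xs "?N (hd xs)" "?N (last xs)"] sym irrefl xs ne N_hd N_last
    unfolding path_def by (metis (mono_tags, lifting) mem_Collect_eq)
  have dist: "distinct ys" using ys(1,2) xs unfolding path_def by (metis card_distinct distinct_card)
  have "V \<subseteq> set ys"
  proof (rule ccontr)
    assume "\<not> ?thesis"
    then obtain w where w: "w \<in> V" "w \<notin> set ys" by blast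
    have "?N (hd xs) \<subseteq> set xs - {hd xs}" using N_hd irrefl by blast
    then have "card (?N (hd xs)) \<le> card (set xs - {hd xs})" by (intro card_mono) auto
    also have "\<dots> = length xs - 1" using xs ne by (simp add: path_def distinct_card)
    finally have long: "card (?N (hd xs)) < length xs" using ne by (cases xs) auto
    have "\<not> ?N w \<subseteq> V - insert w (set ys)"
    proof
      assume "?N w \<subseteq> V - insert w (set ys)"
      then have "card (?N w) \<le> card (V - insert w (set ys))" using V(1) by (intro card_mono) auto
      also have "\<dots> = card V - Suc (length ys)"
        using w ys(1) xs dist distinct_card[OF dist]
        by (subst card_Diff_subset) (auto simp: path_def)
      finally have "card (?N w) \<le> card V - Suc (length ys)" .
      moreover have "card V > 0" using V by (simp add: card_gt_0_iff)
      ultimately show False using long deg[OF ends(1)] deg[OF w(1)] ys(2) by linarith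
    qed
    then obtain x where x: "x \<in> set ys" "adj w x" using irrefl by blast
    then obtain as bs where split: "ys = as @ x # bs" by (meson split_list)
    have "successively adj ((x # bs) @ as)"
    proof (cases "as = []")
      case True
      then show ?thesis using ys(3) split by simp
    next
      case False
      have "successively adj as" "successively adj (x # bs)"
        using ys(3) unfolding split by (simp_all add: successively_append_iff)
      moreover have "adj (last (x # bs)) (hd as)" using ys(4) False unfolding split by simp
      ultimately show ?thesis by (metis successively_append_iff)
    qed
    then have "successively adj (w # x # bs @ as)" using x(2) by simp
    then have "path (w # x # bs @ as)"
      using dist w ys(1) xs unfolding split path_def by auto
    then show False using longest[of "w # x # bs @ as"] ys(2) split by simp
  qed
  then have "set ys = V" using ys(1) xs unfolding path_def by auto
  moreover have "adj (ys ! i) (ys ! (Suc i mod length ys))" if "i < length ys" for i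
  proof (cases "Suc i < length ys")
    case True
    then show ?thesis using ys(3) by (simp add: successively_conv_nth)
  next
    case False
    with that have "length ys = Suc i" by simp
    then show ?thesis using ys(4) by (metis hd_conv_nth last_conv_nth diff_Suc_1 list.size(3)
      mod_self nat.simps(3))
  qed
  ultimately show ?thesis using that[of ys] dist by blast
qed

section \<open>Hall's marriage theorem\<close>

text \<open>
  Rado's argument: while some set \<open>F i\<close> has two elements \<open>x\<close> and \<open>y\<close>, one of them can be removed
  from it without violating Hall's condition. If \<open>A\<close> witnessed the failure for \<open>x\<close> and \<open>B\<close> the
  one for \<open>y\<close>, then, as \<open>F i\<close> is contained in \<open>(F i - {x}) \<union> (F i - {y})\<close>, the condition for
  \<open>insert i (A \<union> B)\<close> and \<open>A \<inter> B\<close> would contradict the modularity of cardinality. When all sets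
  are singletons, Hall's condition for two indices makes them distinct.
\<close>

lemma hall:
  fixes F :: "'i \<Rightarrow> 'b set"
  assumes "finite I" "\<And>i. i \<in> I \<Longrightarrow> finite (F i)"
    and "\<And>J. J \<subseteq> I \<Longrightarrow> card J \<le> card (\<Union>i\<in>J. F i)"
  shows "\<exists>f. inj_on f I \<and> (\<forall>i\<in>I. f i \<in> F i)"
  using assms(2,3)
proof (induction "\<Sum>i\<in>I. card (F i)" arbitrary: F rule: less_induct)
  case less
  note finF = less.prems(1) and hall = less.prems(2)
  have fin: "finite (\<Union>j\<in>J. F j)" if "J \<subseteq> I" for J
    using that finF \<open>finite I\<close> by (meson finite_UN finite_subset subsetD)
  show ?case
  proof (cases "\<exists>i\<in>I. \<exists>x\<in>F i. \<exists>y\<in>F i. x \<noteq> y")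
    case True
    then obtain i x y where i: "i \<in> I" and xy: "x \<in> F i" "y \<in> F i" "x \<noteq> y" by blast
    define G where "G z = F(i := F i - {z})" for z
    have "\<exists>z\<in>{x, y}. \<forall>J\<subseteq>I. card J \<le> card (\<Union>j\<in>J. G z j)"
    proof (rule ccontr)
      assume violated: "\<not> ?thesis"
      \<comment> \<open>A violating set must contain \<open>i\<close>; the index \<open>i\<close> itself is split off.\<close>
      have split_off: "\<exists>A. A \<subseteq> I - {i} \<and> card ((\<Union>j\<in>A. F j) \<union> (F i - {z})) \<le> card A"
        if z: "z \<in> {x, y}" for z
      proof -
        obtain J where J: "J \<subseteq> I" "card (\<Union>j\<in>J. G z j) < card J"
          using violated z not_le by blast
        have "i \<in> J"
        proof (rule ccontr)
          assume "i \<notin> J"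
          then have "(\<Union>j\<in>J. G z j) = (\<Union>j\<in>J. F j)" by (auto simp: G_def)
          then show False using J hall by (metis not_le)
        qed
        then have "(\<Union>j\<in>J. G z j) = (\<Union>j\<in>J - {i}. F j) \<union> (F i - {z})"
          by (auto simp: G_def split: if_splits)
        moreover have "card J = Suc (card (J - {i}))"
          using \<open>i \<in> J\<close> J(1) \<open>finite I\<close> by (metis card.remove finite_subset)
        ultimately show ?thesis using J by (intro exI[of _ "J - {i}"]) auto
      qed
      obtain A where A: "A \<subseteq> I - {i}" "card ((\<Union>j\<in>A. F j) \<union> (F i - {x})) \<le> card A"
        using split_off[of x] by auto
      obtain B where B: "B \<subseteq> I - {i}" "card ((\<Union>j\<in>B. F j) \<union> (F i - {y})) \<le> card B"
        using split_off[of y] by auto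
      let ?U = "(\<Union>j\<in>A. F j) \<union> (F i - {x})" and ?W = "(\<Union>j\<in>B. F j) \<union> (F i - {y})"
      have fins: "finite A" "finite B" using A(1) B(1) \<open>finite I\<close> by (auto intro: finite_subset)
      have finUW: "finite ?U" "finite ?W"
        using A(1) B(1) fin[of A] fin[of B] finF[OF i] by blast+
      have "?U \<union> ?W = (\<Union>j\<in>insert i (A \<union> B). F j)" using xy(3) by auto
      moreover have "insert i (A \<union> B) \<subseteq> I" "i \<notin> A \<union> B" using A(1) B(1) i by auto
      ultimately have "Suc (card (A \<union> B)) \<le> card (?U \<union> ?W)"
        using hall[of "insert i (A \<union> B)"] fins by simp
      moreover have "card (A \<inter> B) \<le> card (?U \<inter> ?W)"
      proof -
        have "A \<inter> B \<subseteq> I" using A(1) by blast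
        then have "card (A \<inter> B) \<le> card (\<Union>j\<in>A \<inter> B. F j)" by (rule hall)
        also have "\<dots> \<le> card (?U \<inter> ?W)" using finUW(1) by (intro card_mono) blast+
        finally show ?thesis .
      qed
      moreover have "card ?U + card ?W = card (?U \<union> ?W) + card (?U \<inter> ?W)"
        by (rule card_Un_Int[OF finUW])
      moreover have "card A + card B = card (A \<union> B) + card (A \<inter> B)"
        by (rule card_Un_Int[OF fins])
      ultimately show False using A(2) B(2) by linarith
    qed
    then obtain z where z: "z \<in> {x, y}" "\<And>J. J \<subseteq> I \<Longrightarrow> card J \<le> card (\<Union>j\<in>J. G z j)"
      by blast
    have sub: "G z j \<subseteq> F j" for j by (auto simp: G_def)
    have "(\<Sum>j\<in>I. card (G z j)) < (\<Sum>j\<in>I. card (F j))"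
    proof (rule sum_strict_mono_ex1[OF \<open>finite I\<close>])
      show "\<forall>j\<in>I. card (G z j) \<le> card (F j)" using sub finF by (auto intro: card_mono)
      have "card (G z i) < card (F i)"
        using z(1) xy i finF by (intro psubset_card_mono) (auto simp: G_def)
      then show "\<exists>j\<in>I. card (G z j) < card (F j)" using i by blast
    qed
    then obtain f where "inj_on f I" "\<forall>j\<in>I. f j \<in> G z j"
      using less.hyps[of "G z"] z(2) sub finF by (meson finite_subset)
    then show ?thesis using sub by blast
  next
    case False
    have ne: "F i \<noteq> {}" if "i \<in> I" for i using hall[of "{i}"] that by auto
    define f where "f i = (SOME x. x \<in> F i)" for i
    have f: "F i = {f i}" if "i \<in> I" for i
      using False ne[OF that] that someI_ex[of "\<lambda>x. x \<in> F i"] unfolding f_def by blast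
    have "inj_on f I"
    proof (rule inj_onI, rule ccontr)
      fix i j assume ij: "i \<in> I" "j \<in> I" "f i = f j" "i \<noteq> j"
      then show False using hall[of "{i, j}"] f[of i] f[of j] by simp
    qed
    then show ?thesis using f by blast
  qed
qed

text \<open>
  The incidences between \<open>J\<close> and the union of its sets number at least \<open>d * card J\<close> and at most
  \<open>d\<close> times the size of the union, which is Hall's condition.
\<close>

lemma hall_of_degrees:
  fixes F :: "'i \<Rightarrow> 'b set"
  assumes "finite I" "\<And>i. i \<in> I \<Longrightarrow> finite (F i)" and "d > 0"
    and lower: "\<And>i. i \<in> I \<Longrightarrow> d \<le> card (F i)"
    and upper: "\<And>e. card {i \<in> I. e \<in> F i} \<le> d"
  shows "\<exists>f. inj_on f I \<and> (\<forall>i\<in>I. f i \<in> F i)"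
proof (rule hall[OF assms(1,2)])
  fix J assume J: "J \<subseteq> I"
  let ?U = "\<Union>i\<in>J. F i"
  have finJ: "finite J" using J \<open>finite I\<close> finite_subset by blast
  have finU: "finite ?U" using finJ J assms(2) by blast
  have "card J * d \<le> (\<Sum>i\<in>J. card (F i))"
    using sum_bounded_below[of J d "\<lambda>i. card (F i)"] lower J by auto
  also have "\<dots> = (\<Sum>i\<in>J. card {e \<in> ?U. e \<in> F i})"
    by (intro sum.cong refl arg_cong[where f = card]) auto
  also have "\<dots> = (\<Sum>e\<in>?U. card {i \<in> J. e \<in> F i})"
    using sum.swap_restrict[OF finJ finU, of "\<lambda>_ _. 1::nat" "\<lambda>i e. e \<in> F i"] by simp
  also have "\<dots> \<le> card ?U * d"
  proof -
    have "card {i \<in> J. e \<in> F i} \<le> d" for e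
      using upper[of e] card_mono[of "{i \<in> I. e \<in> F i}" "{i \<in> J. e \<in> F i}"] J \<open>finite I\<close>
      by fastforce
    then show ?thesis using sum_bounded_above[of ?U "\<lambda>e. card {i \<in> J. e \<in> F i}" d] by simp
  qed
  finally show "card J \<le> card ?U" using \<open>d > 0\<close> by simp
qed

section \<open>Edges and cyclically consecutive vertices\<close>

text \<open>
  Among the indices of the elements of \<open>e\<close> at least one has its cyclic successor outside, since a
  nonempty set of indices closed under the successor contains all indices.
\<close>

lemma card_consecutive_pairs_less:
  fixes vs :: "'a list"
  assumes dist: "distinct vs" and e: "e \<noteq> {}" "e \<subset> set vs"
  shows "card {i. i < length vs \<and> vs ! i \<in> e \<and> vs ! (Suc i mod length vs) \<in> e} < card e"
proof -
  let ?n = "length vs"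
  let ?P = "{i. i < ?n \<and> vs ! i \<in> e \<and> vs ! (Suc i mod ?n) \<in> e}"
  define I where "I = {i. i < ?n \<and> vs ! i \<in> e}"
  have img: "(!) vs ` I = e"
    using e(2) unfolding I_def by (auto simp: in_set_conv_nth image_iff dest!: psubset_imp_subset)
      (metis in_set_conv_nth subsetD)
  have "inj_on ((!) vs) I" using dist by (auto simp: inj_on_def I_def nth_eq_iff_index_eq)
  then have card_I: "card I = card e" using img card_image by metis
  have "?P \<noteq> I"
  proof
    assume PI: "?P = I"
    obtain i where i: "i \<in> I" using img e(1) by blast
    have all: "(i + j) mod ?n \<in> I" for j
    proof (induction j)
      case 0
      then show ?case using i by (simp add: I_def)
    next
      case (Suc j)
      then have "(i + j) mod ?n \<in> ?P" using PI by simp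
      then have "Suc ((i + j) mod ?n) mod ?n \<in> I"
        by (auto simp: I_def intro!: mod_less_divisor)
      then show ?case by (simp add: mod_Suc_eq)
    qed
    have "m \<in> I" if "m < ?n" for m
      using all[of "?n - i + m"] i that by (simp add: I_def)
    then have "set vs \<subseteq> e" by (auto simp: I_def in_set_conv_nth)
    then show False using e(2) by blast
  qed
  then have "?P \<subset> I" by (auto simp: I_def)
  then have "card ?P < card I" by (intro psubset_card_mono) (auto simp: I_def)
  then show ?thesis using card_I by simp
qed

text \<open>The co-degree of \<open>S\<close> bounds the candidates for the maximum, which is therefore attained.\<close>

lemma min_pos_codegree_le:
  assumes "S \<in> nsets V (r - 1)" "codegree E S \<noteq> 0"
  shows "min_pos_codegree r V E \<le> codegree E S"
proof -
  let ?P = "\<lambda>k. \<forall>S \<in> nsets V (r - 1). codegree E S = 0 \<or> k \<le> codegree E S"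
  have "?P (Greatest ?P)"
    using assms by (intro GreatestI_ex_nat[of ?P "codegree E S"]) (auto intro!: exI[of _ 0])
  moreover have "E \<noteq> {}" using assms(2) by (auto simp: codegree_def)
  ultimately show ?thesis using assms unfolding min_pos_codegree_def by auto
qed

lemma min_pos_codegree_le_of_subset:
  assumes H: "rgraph r V E" and "e \<in> E" "S \<subseteq> e" "card S = r - 1"
  shows "min_pos_codegree r V E \<le> codegree E S"
proof (rule min_pos_codegree_le)
  have V: "finite V" "E \<subseteq> nsets V r" using H by (auto simp: rgraph_def)
  then show "S \<in> nsets V (r - 1)" using assms(2-4) by (auto simp: nsets_def intro: finite_subset)
  have "finite E" using V finite_imp_finite_nsets finite_subset by blast
  then show "codegree E S \<noteq> 0" using assms(2,3) by (auto simp: codegree_def)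
qed

text \<open>
  An edge through \<open>v\<close> has an \<open>(r - 1)\<close>-subset \<open>S\<close> through \<open>v\<close>. The other elements of \<open>S\<close>
  are neighbours of \<open>v\<close>, and so are the vertices that extend \<open>S\<close> to an edge, one for each edge
  that contains \<open>S\<close>.
\<close>

lemma shadow_degree:
  assumes H: "rgraph r V E" and r: "r \<ge> 2" and v: "e \<in> E" "v \<in> e"
  shows "min_pos_codegree r V E + (r - 2) \<le> card {w \<in> V. w \<noteq> v \<and> (\<exists>e\<in>E. v \<in> e \<and> w \<in> e)}"
    (is "_ \<le> card ?N")
proof -
  have V: "finite V" "E \<subseteq> nsets V r" using H by (auto simp: rgraph_def)
  have edge: "f \<subseteq> V" "finite f" "card f = r" if "f \<in> E" for f
    using V(2) that by (auto simp: nsets_def)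
  have "r - 2 \<le> card (e - {v})" using edge[OF v(1)] v(2) by simp
  then obtain T where T: "T \<subseteq> e - {v}" "card T = r - 2" "finite T"
    by (rule obtain_subset_with_card_n)
  let ?S = "insert v T"
  have S: "?S \<subseteq> e" "card ?S = r - 1" using T v(2) r by (auto simp: card_insert_if)
  let ?X = "{w \<in> V. w \<notin> ?S \<and> insert w ?S \<in> E}"
  have "{f \<in> E. ?S \<subseteq> f} \<subseteq> (\<lambda>w. insert w ?S) ` ?X"
  proof
    fix f assume "f \<in> {f \<in> E. ?S \<subseteq> f}"
    then have f: "f \<in> E" "?S \<subseteq> f" by auto
    have "card (f - ?S) = 1" using edge[OF f(1)] f(2) S(2) T(3) r by (simp add: card_Diff_subset)
    then obtain w where "f - ?S = {w}" by (metis card_1_singletonE)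
    then have "f = insert w ?S" "w \<notin> ?S" using f(2) by blast+
    then show "f \<in> (\<lambda>w. insert w ?S) ` ?X" using f(1) edge(1)[OF f(1)] by auto
  qed
  then have "codegree E ?S \<le> card ?X"
    unfolding codegree_def using V(1) by (intro surj_card_le) auto
  then have "min_pos_codegree r V E \<le> card ?X"
    using min_pos_codegree_le_of_subset[OF H v(1) S] by linarith
  moreover have "card (?X \<union> T) = card ?X + card T"
    using V(1) T(3) by (intro card_Un_disjoint) auto
  moreover have "card (?X \<union> T) \<le> card ?N"
    using V(1) T(1) v edge(1)[OF v(1)] by (intro card_mono) auto
  ultimately show ?thesis using T(2) by linarith
qed

text \<open>For \<open>r \<ge> 3\<close> the pair extends to an \<open>(r - 1)\<close>-subset of the edge \<open>e\<close>.\<close>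

lemma pair_codegree:
  assumes H: "rgraph r V E" and r: "r \<ge> 3" and e: "e \<in> E" "u \<in> e" "w \<in> e"
  shows "min_pos_codegree r V E \<le> codegree E {u, w}"
proof -
  have V: "finite V" "E \<subseteq> nsets V r" using H by (auto simp: rgraph_def)
  then have "finite E" using finite_imp_finite_nsets finite_subset by blast
  have "finite e" "card e = r" using V(2) e(1) by (auto simp: nsets_def)
  moreover have "card {u, w} \<le> r - 1" using r by (cases "u = w") auto
  moreover have "{u, w} \<subseteq> e" using e by simp
  ultimately obtain S where S: "{u, w} \<subseteq> S" "S \<subseteq> e" "card S = r - 1"
    using exists_subset_between[of "{u, w}" "r - 1" e] by (metis diff_le_self)
  have "codegree E S \<le> codegree E {u, w}"
    unfolding codegree_def using \<open>finite E\<close> S(1) by (intro card_mono) auto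
  then show ?thesis using min_pos_codegree_le_of_subset[OF H e(1) S(2,3)] by linarith
qed

section \<open>Berge Hamiltonian cycles\<close>

theorem theorem1p8:
  fixes r n :: nat and V :: "'a set" and E :: "'a set set"
  assumes "r \<ge> 2"
    and "int n \<ge> 6 * int r - 10"
    and "n \<ge> 3"
    and "rgraph r V E"
    and "card V = n"
    and "real (min_pos_codegree r V E) \<ge> real n / 2 - real r + 2"
    and "\<forall>v\<in>V. \<not> isolated E v"
  shows "\<exists>vs es. berge_hamiltonian_cycle V E vs es"
proof -
  note H = \<open>rgraph r V E\<close>
  have V: "finite V" "E \<subseteq> nsets V r" using H by (auto simp: rgraph_def)
  have "finite E" using V finite_imp_finite_nsets finite_subset by blast
  define adj where "adj u w \<longleftrightarrow> w \<noteq> u \<and> (\<exists>e\<in>E. u \<in> e \<and> w \<in> e)" for u w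
  have deg: "card V \<le> 2 * card {w \<in> V. adj v w}" if v: "v \<in> V" for v
  proof -
    obtain e where "e \<in> E" "v \<in> e" using assms(7) v by (auto simp: isolated_def)
    then have "min_pos_codegree r V E + (r - 2) \<le> card {w \<in> V. adj v w}"
      using shadow_degree[OF H assms(1)] by (simp add: adj_def)
    then have "real (min_pos_codegree r V E) + (real r - 2) \<le> real (card {w \<in> V. adj v w})"
      using assms(1) by linarith
    then show ?thesis using assms(5,6) by linarith
  qed
  have "V \<noteq> {}" using assms(3,5) by auto
  obtain vs where vs: "distinct vs" "set vs = V"
    and cyc: "\<And>i. i < length vs \<Longrightarrow> adj (vs ! i) (vs ! (Suc i mod length vs))"
  proof (rule dirac[of V adj])
    show "adj w u" if "adj u w" for u w using that unfolding adj_def by blast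
    show "\<not> adj u u" for u unfolding adj_def by blast
  qed (use V(1) \<open>V \<noteq> {}\<close> deg in blast)+
  have len: "length vs = n" using vs assms(5) distinct_card by force
  define F where "F i = {e \<in> E. {vs ! i, vs ! (Suc i mod n)} \<subseteq> e}" for i
  have "\<exists>f. inj_on f {..<n} \<and> (\<forall>i\<in>{..<n}. f i \<in> F i)"
  proof (rule hall_of_degrees[where d = "r - 1"])
    fix i assume "i \<in> {..<n}"
    then obtain e where e: "e \<in> E" "vs ! i \<in> e" "vs ! (Suc i mod n) \<in> e"
      using cyc[of i] len by (auto simp: adj_def)
    show "r - 1 \<le> card (F i)"
    proof (cases "r = 2")
      case True
      have "F i \<noteq> {}" "finite (F i)" using e \<open>finite E\<close> by (auto simp: F_def)
      then show ?thesis using True by (simp add: Suc_le_eq card_gt_0_iff)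
    next
      case False
      then have "min_pos_codegree r V E \<le> card (F i)"
        using pair_codegree[OF H _ e] assms(1) by (simp add: F_def codegree_def)
      moreover have "r - 1 \<le> min_pos_codegree r V E"
        using assms(1,2,6) False by linarith
      ultimately show ?thesis by linarith
    qed
  next
    fix e
    show "card {i \<in> {..<n}. e \<in> F i} \<le> r - 1"
    proof (cases "e \<in> E")
      case True
      then have e: "e \<subseteq> V" "card e = r" using V(2) by (auto simp: nsets_def)
      have "r < n" using assms(1,2,3) by linarith
      then have "e \<noteq> {}" "e \<subset> set vs" using e vs(2) assms(1,5) by auto
      then have "card {i. i < n \<and> vs ! i \<in> e \<and> vs ! (Suc i mod n) \<in> e} < r"
        using card_consecutive_pairs_less[OF vs(1), of e] e(2) len by simp
      then show ?thesis using True by (simp add: F_def)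
    next
      case False
      then show ?thesis by (simp add: F_def)
    qed
  qed (use \<open>finite E\<close> assms(1) in \<open>auto simp: F_def\<close>)
  then obtain f where f: "inj_on f {..<n}" "\<And>i. i < n \<Longrightarrow> f i \<in> F i" by auto
  have "berge_cycle V E n vs (map f [0..<n])"
    using assms(3) vs len f by (auto simp: berge_cycle_def F_def distinct_map atLeast0LessThan)
  then show ?thesis using assms(5) unfolding berge_hamiltonian_cycle_def by blast
qed

end
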